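(* Consider an MDP-JLS with MDP $\mathcal{M}=(S,\hat{s},\Sigma,T)$, $S=\{s_1,\dots,s_N\}$, and mode matrices $A_1,\dots,A_N\in\mathbb{R}^{n\times n}$. Suppose there exist symmetric matrices $V_1,\dots,V_N\in\mathbb{R}^{n\times n}$ and a policy $\pi$ such that, for all $i,j\in\{1,\dots,N\}$ and $\sigma\in\Sigma$, $$V_i>0,\qquad V_j-\mathcal{T}_j(V)>0,\qquad \mathcal{T}_j(V)=\sum_{i=1}^N P_{ij}A_iV_iA_i',$$ $$P_{ij}=\sum_{\sigma\in\Sigma}T(i,\sigma,j)\,\pi(i,\sigma),\qquad \sum_{\sigma\in\Sigma}\pi(i,\sigma)=1,\qquad \pi(i,\sigma)\ge 0 .$$ Then the MJLS induced by $\pi$ is mean-square stable.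
   Context: An MDP is a tuple $\mathcal{M}=(S,\hat{s},\Sigma,T)$ with finite state set $S=\{s_1,\dots,s_N\}$, initial state $\hat s\in S$, finite action set $\Sigma$, and transition function $T:S\times\Sigma\times S\to[0,1]$, $T(s,\sigma,s')=p(s'|s,\sigma)$; write $T(i,\sigma,j)$ for $T(s_i,\sigma,s_j)$. If $\sigma$ is available at $s_i$ then $T(i,\sigma,\cdot)$ is a probability distribution; if $\sigma$ is not available at $s_i$ then $T(i,\sigma,j)=0$ for all $j$, and policies do not select it. A (randomized) policy $\pi:S\times\Sigma\to[0,1]$ gives the probability $\pi(i,\sigma)$ of taking action $\sigma$ at $s_i$ (so $\pi(i,\cdot)$ is a probability distribution on $\Sigma$ supported on the available actions). Under $\pi$ the MDP reduces to a discrete-time Markov chain (DTMC) $(S,\hat s,P)$ with $P_{ij}=\sum_{\sigma}T(i,\sigma,j)\pi(i,\sigma)$. An MDP-JLS is the switched system $x(k+1)=A_{s_k}x(k)$, $x(k)\in\mathbb{R}^n$, with matrix $A_i\in\mathbb{R}^{n\times n}$ used when the mode at time $k$ is $s_i$, and with the mode process governed by $\mathcal{M}$. Given a policy $\pi$, it becomes a Markov jump linear system (MJLS): the modes follow the induced DTMC. An MJLS is mean-square stable if $\lim_{k\to\infty}\|E[x(k)x'(k)]\|_\infty=0$ for any initial condition $x_0$. Here $'$ denotes transpose, and $A>0$ means $A$ is (symmetric) positive definite. *)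

theory Defs
  imports "HOL-Probability.Probability"
begin

text \<open>
  The state set and the action set are the (finite) types \<open>'s\<close> and \<open>'a\<close>.  Availability of an
  action is read off from the transition function: \<open>\<sigma>\<close> is available at \<open>i\<close> iff \<open>T(i, \<sigma>, \<cdot>)\<close> is not
  identically zero, since an available action has a probability distribution there and an
  unavailable one has the zero function.
\<close>

record ('s, 'a) mdp =
  mdp_init :: 's
  mdp_trans :: "'s \<Rightarrow> 'a \<Rightarrow> 's \<Rightarrow> real"

definition available :: "('s, 'a) mdp \<Rightarrow> 's \<Rightarrow> 'a \<Rightarrow> bool" where
  "available \<M> i \<sigma> \<longleftrightarrow> (\<exists>j. mdp_trans \<M> i \<sigma> j \<noteq> 0)"

definition is_mdp :: "('s::finite, 'a::finite) mdp \<Rightarrow> bool" where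
  "is_mdp \<M> \<longleftrightarrow>
     (\<forall>i \<sigma> j. mdp_trans \<M> i \<sigma> j \<in> {0..1}) \<and>
     (\<forall>i \<sigma>. available \<M> i \<sigma> \<longrightarrow> (\<Sum>j\<in>UNIV. mdp_trans \<M> i \<sigma> j) = 1)"

definition is_policy :: "('s::finite, 'a::finite) mdp \<Rightarrow> ('s \<Rightarrow> 'a \<Rightarrow> real) \<Rightarrow> bool" where
  "is_policy \<M> \<pi> \<longleftrightarrow>
     (\<forall>i \<sigma>. \<pi> i \<sigma> \<ge> 0) \<and>
     (\<forall>i. (\<Sum>\<sigma>\<in>UNIV. \<pi> i \<sigma>) = 1) \<and>
     (\<forall>i \<sigma>. \<not> available \<M> i \<sigma> \<longrightarrow> \<pi> i \<sigma> = 0)"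

definition induced_trans ::
  "('s::finite, 'a::finite) mdp \<Rightarrow> ('s \<Rightarrow> 'a \<Rightarrow> real) \<Rightarrow> 's \<Rightarrow> 's \<Rightarrow> real" where
  "induced_trans \<M> \<pi> i j = (\<Sum>\<sigma>\<in>UNIV. mdp_trans \<M> i \<sigma> j * \<pi> i \<sigma>)"

text \<open>
  \<open>is_dtmc \<Omega> \<theta> s0 P\<close>: on the probability space \<open>\<Omega>\<close>, the process \<open>\<theta>\<close> is a time-homogeneous Markov
  chain started in \<open>s0\<close> with transition matrix \<open>P\<close>.  Histories \<open>h\<close> of probability zero are excluded
  because \<open>cond_prob\<close> is \<open>0\<close> by convention there.
\<close>

definition is_dtmc ::
  "'w measure \<Rightarrow> (nat \<Rightarrow> 'w \<Rightarrow> 's::finite) \<Rightarrow> 's \<Rightarrow> ('s \<Rightarrow> 's \<Rightarrow> real) \<Rightarrow> bool" where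
  "is_dtmc \<Omega> \<theta> s0 P \<longleftrightarrow>
     prob_space \<Omega> \<and>
     (\<forall>k. \<theta> k \<in> \<Omega> \<rightarrow>\<^sub>M count_space UNIV) \<and>
     (AE \<omega> in \<Omega>. \<theta> 0 \<omega> = s0) \<and>
     (\<forall>k h j. \<P>(\<omega> in \<Omega>. \<forall>l\<le>k. \<theta> l \<omega> = h l) > 0 \<longrightarrow>
        \<P>(\<omega> in \<Omega>. \<theta> (Suc k) \<omega> = j \<bar> \<forall>l\<le>k. \<theta> l \<omega> = h l) = P (h k) j)"

primrec jls_state ::
  "('s \<Rightarrow> real^'n^'n) \<Rightarrow> (nat \<Rightarrow> 's) \<Rightarrow> real^'n \<Rightarrow> nat \<Rightarrow> real^'n" where
  "jls_state A m x0 0 = x0"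
| "jls_state A m x0 (Suc k) = A (m k) *v jls_state A m x0 k"

definition outer_self :: "real^'n \<Rightarrow> real^'n^'n" where
  "outer_self x = (\<chi> i j. x $ i * x $ j)"

text \<open>The matrix norm induced by the vector maximum norm: the maximal absolute row sum.\<close>

definition matrix_norm_inf :: "real^'n^'m \<Rightarrow> real" where
  "matrix_norm_inf B = Max (range (\<lambda>i. \<Sum>j\<in>UNIV. \<bar>B $ i $ j\<bar>))"

definition mean_square_stable ::
  "'w measure \<Rightarrow> (nat \<Rightarrow> 'w \<Rightarrow> 's) \<Rightarrow> ('s \<Rightarrow> real^'n^'n) \<Rightarrow> bool" where
  "mean_square_stable \<Omega> \<theta> A \<longleftrightarrow>
     (\<forall>x0. (\<lambda>k. matrix_norm_inf
                  (prob_space.expectation \<Omega>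
                     (\<lambda>\<omega>. outer_self (jls_state A (\<lambda>l. \<theta> l \<omega>) x0 k))))
           \<longlonglongrightarrow> 0)"

definition pos_def :: "real^'n^'n \<Rightarrow> bool" where
  "pos_def B \<longleftrightarrow> transpose B = B \<and> (\<forall>x. x \<noteq> 0 \<longrightarrow> x \<bullet> (B *v x) > 0)"

definition lyapunov_op ::
  "('s::finite \<Rightarrow> real^'n^'n) \<Rightarrow> ('s \<Rightarrow> 's \<Rightarrow> real) \<Rightarrow> ('s \<Rightarrow> real^'n^'n) \<Rightarrow> 's \<Rightarrow> real^'n^'n" where
  "lyapunov_op A P V j = (\<Sum>i\<in>UNIV. P i j *\<^sub>R (A i ** V i ** transpose (A i)))"

end

theory Submission
  imports Defs
begin

text \<open>
  For a vector \<open>y\<close> put \<open>q\<^sub>j(k, y) = E[(y \<bullet> x(k))\<^sup>2; \<theta>(k) = j]\<close>.  The Markov property gives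
  \<open>q\<^sub>j(k + 1, y) = (\<Sum>i. P\<^sub>i\<^sub>j q\<^sub>i(k, A\<^sub>i' y))\<close>.  By compactness of the sphere there is \<open>\<rho> < 1\<close> with
  \<open>y \<bullet> \<T>\<^sub>j(V) y \<le> \<rho> (y \<bullet> V\<^sub>j y)\<close>, so \<open>q\<^sub>j(k, y) \<le> c \<rho>\<^sup>k (y \<bullet> V\<^sub>j y)\<close> by induction on \<open>k\<close>.
  Taking \<open>y\<close> to be a unit vector controls the diagonal of \<open>E[x(k) x(k)']\<close>, and
  \<open>2 |x\<^sub>a x\<^sub>b| \<le> x\<^sub>a\<^sup>2 + x\<^sub>b\<^sup>2\<close> controls the remaining entries.
\<close>

section \<open>Quadratic forms\<close>

text \<open>The form is continuous, so it attains its minimum on the compact unit sphere. That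
  minimum serves as \<epsilon>: definiteness makes it positive, and homogeneity of degree two
  carries the bound to all \<open>y\<close>.\<close>

lemma pos_def_coercive:
  fixes B :: "real^'n^'n"
  assumes "pos_def B"
  shows "\<exists>\<epsilon>>0. \<forall>y. \<epsilon> * (y \<bullet> y) \<le> y \<bullet> (B *v y)"
proof -
  let ?S = "sphere (0 :: real^'n) 1"
  have "continuous_on ?S (\<lambda>y. y \<bullet> (B *v y))"
    by (intro continuous_intros matrix_vector_mult_linear_continuous_on)
  moreover have "?S \<noteq> {}"
    by simp
  ultimately obtain z where z: "z \<in> ?S" and min: "\<And>y. y \<in> ?S \<Longrightarrow> z \<bullet> (B *v z) \<le> y \<bullet> (B *v y)"
    using continuous_attains_inf[of ?S "\<lambda>y. y \<bullet> (B *v y)"] by auto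
  let ?e = "z \<bullet> (B *v z)"
  have "?e * (y \<bullet> y) \<le> y \<bullet> (B *v y)" for y
  proof (cases "y = 0")
    case False
    define u where "u = (1 / norm y) *\<^sub>R y"
    have y: "y = norm y *\<^sub>R u" and u: "u \<in> ?S"
      using False by (auto simp: u_def)
    have "y \<bullet> (B *v y) = (norm y)\<^sup>2 * (u \<bullet> (B *v u))"
      by (subst (1 2) y) (simp add: matrix_vector_mult_scaleR power2_eq_square)
    then show ?thesis
      using min[OF u] by (simp add: dot_square_norm mult.commute mult_right_mono)
  qed simp
  moreover have "z \<noteq> 0"
    using z by auto
  then have "?e > 0"
    using assms by (simp add: pos_def_def)
  ultimately show ?thesis by blast
qed

lemma pos_def_coercive_uniform:
  fixes B :: "'s::finite \<Rightarrow> real^'n^'n"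
  assumes "\<And>j. pos_def (B j)"
  shows "\<exists>\<epsilon>>0. \<forall>j y. \<epsilon> * (y \<bullet> y) \<le> y \<bullet> (B j *v y)"
proof -
  obtain e where e: "\<And>j. e j > 0" "\<And>j y. e j * (y \<bullet> y) \<le> y \<bullet> (B j *v y)"
    using pos_def_coercive[OF assms] by metis
  have "Min (range e) * (y \<bullet> y) \<le> y \<bullet> (B j *v y)" for j y
    by (rule order_trans[OF mult_right_mono e(2)[of j]]) auto
  moreover have "Min (range e) > 0"
    using e(1) by (subst Min_gr_iff) auto
  ultimately show ?thesis by blast
qed

lemma quadratic_form_bounded_uniform:
  fixes B :: "'s::finite \<Rightarrow> real^'n^'n"
  shows "\<exists>K>0. \<forall>j y. y \<bullet> (B j *v y) \<le> K * (y \<bullet> y)"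
proof -
  \<comment> \<open>A sum of nonnegative operator norms dominates each summand, so one constant
    serves all modes; the added 1 makes it strictly positive.\<close>
  define K where "K = 1 + (\<Sum>j\<in>UNIV. onorm ((*v) (B j)))"
  have nonneg: "onorm ((*v) (B j)) \<ge> 0" for j
    by (rule onorm_pos_le) (simp add: matrix_vector_mul_bounded_linear)
  have le: "onorm ((*v) (B j)) \<le> K" for j
    using member_le_sum[of j UNIV "\<lambda>j. onorm ((*v) (B j))"] nonneg by (simp add: K_def)
  have "y \<bullet> (B j *v y) \<le> K * (y \<bullet> y)" for j y
  proof -
    have "y \<bullet> (B j *v y) \<le> norm y * norm (B j *v y)"
      by (rule norm_cauchy_schwarz)
    also have "\<dots> \<le> norm y * (onorm ((*v) (B j)) * norm y)"
      by (intro mult_left_mono onorm) (simp_all add: matrix_vector_mul_bounded_linear)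
    also have "\<dots> \<le> norm y * (K * norm y)"
      by (intro mult_left_mono mult_right_mono le) auto
    finally show ?thesis
      by (simp add: dot_square_norm power2_eq_square mult_ac)
  qed
  moreover have "K > 0"
    using sum_nonneg[of UNIV "\<lambda>j. onorm ((*v) (B j))"] nonneg by (simp add: K_def)
  ultimately show ?thesis by blast
qed

text \<open>The gap between the two forms is at least \<open>e * (y \<bullet> y)\<close>, while the
  form of \<open>V j\<close> is at most \<open>K * (y \<bullet> y)\<close>. Hence the gap is at
  least a fixed fraction of the form of \<open>V j\<close>, uniformly in \<open>j\<close> and
  \<open>y\<close>.\<close>

lemma pos_def_contraction:
  fixes V W :: "'s::finite \<Rightarrow> real^'n^'n"
  assumes "\<And>j. pos_def (V j)" and "\<And>j. pos_def (V j - W j)"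
  shows "\<exists>\<rho>. 0 \<le> \<rho> \<and> \<rho> < 1 \<and> (\<forall>j y. y \<bullet> (W j *v y) \<le> \<rho> * (y \<bullet> (V j *v y)))"
proof -
  obtain e where e: "e > 0" "\<And>j y. e * (y \<bullet> y) \<le> y \<bullet> ((V j - W j) *v y)"
    using pos_def_coercive_uniform[of "\<lambda>j. V j - W j"] assms(2) by metis
  obtain K where K: "K > 0" "\<And>j y. y \<bullet> (V j *v y) \<le> K * (y \<bullet> y)"
    using quadratic_form_bounded_uniform[of V] by metis
  \<comment> \<open>The denominator \<open>K + e\<close>, instead of \<open>K\<close>, gives
    \<open>r * K \<le> e\<close> and also \<open>r < 1\<close>. The latter keeps the factor
    \<open>1 - r\<close> nonnegative even if \<open>e\<close> exceeds \<open>K\<close>, which is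
    possible because \<open>W\<close> may have negative directions.\<close>
  define r where "r = e / (K + e)"
  have "y \<bullet> (W j *v y) \<le> (1 - r) * (y \<bullet> (V j *v y))" for j y
  proof -
    have "r * (y \<bullet> (V j *v y)) \<le> r * (K * (y \<bullet> y))"
      using K e by (intro mult_left_mono) (auto simp: r_def)
    also have "\<dots> = (r * K) * (y \<bullet> y)" by simp
    also have "\<dots> \<le> e * (y \<bullet> y)"
      using K(1) e(1) by (intro mult_right_mono) (auto simp: r_def field_simps)
    also have "\<dots> \<le> y \<bullet> (V j *v y) - y \<bullet> (W j *v y)"
      using e(2)[of y j] by (simp add: matrix_vector_mult_diff_rdistrib inner_diff_right)
    finally show ?thesis by (simp add: algebra_simps)
  qed
  moreover have "0 \<le> 1 - r" "1 - r < 1"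
    using K e by (auto simp: r_def field_simps)
  ultimately show ?thesis by blast
qed

text \<open>Each \<open>A i\<close> moves across the inner product as its transpose. The result has
  the same weights and the same vectors as the recursion for the second moments, so the two can be
  compared term by term.\<close>

lemma inner_lyapunov_op:
  "y \<bullet> (lyapunov_op A P V j *v y) =
     (\<Sum>i\<in>UNIV. P i j * ((transpose (A i) *v y) \<bullet> (V i *v (transpose (A i) *v y))))"
proof -
  have "lyapunov_op A P V j *v y =
      (\<Sum>i\<in>UNIV. P i j *\<^sub>R ((A i ** V i ** transpose (A i)) *v y))"
    unfolding lyapunov_op_def
    by (induction rule: finite_induct[OF finite_class.finite_UNIV])
      (simp_all add: matrix_vector_mult_add_rdistrib scaleR_matrix_vector_assoc)
  moreover have "y \<bullet> ((A i ** V i ** transpose (A i)) *v y) =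
      (transpose (A i) *v y) \<bullet> (V i *v (transpose (A i) *v y))" for i
    by (simp add: matrix_vector_mul_assoc[symmetric] dot_lmul_matrix[symmetric])
  ultimately show ?thesis by (simp add: inner_sum_right)
qed

section \<open>Functionals of the history of a Markov chain\<close>

text \<open>Plays the role of measurability with respect to the modes at times 0 to
  \<open>k\<close>. With finitely many modes, such a functional takes only finitely many
  values.\<close>

definition depends_upto :: "nat \<Rightarrow> ((nat \<Rightarrow> 's) \<Rightarrow> 'b) \<Rightarrow> bool" where
  "depends_upto k f \<longleftrightarrow> (\<forall>m m'. (\<forall>l\<le>k. m l = m' l) \<longrightarrow> f m = f m')"

lemma jls_state_cong:
  "(\<And>l. l < k \<Longrightarrow> m l = m' l) \<Longrightarrow> jls_state A m x0 k = jls_state A m' x0 k"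
  by (induction k) auto

lemma depends_upto_jls_state:
  "depends_upto k (\<lambda>m. f (m k) (jls_state A m x0 k))"
  unfolding depends_upto_def
proof (intro allI impI)
  fix m m' :: "nat \<Rightarrow> 'a"
  assume "\<forall>l\<le>k. m l = m' l"
  then show "f (m k) (jls_state A m x0 k) = f (m' k) (jls_state A m' x0 k)"
    using jls_state_cong[of k m m' A x0] by simp
qed

lemma sum_mult_indicator_singleton:
  fixes g :: "'s::finite \<Rightarrow> real"
  shows "(\<Sum>i\<in>UNIV. g i * indicator {i} s) = g s"
proof -
  have "(\<Sum>i\<in>UNIV. g i * indicator {i} s) = (\<Sum>i\<in>UNIV. if i = s then g i else 0)"
    by (intro sum.cong) auto
  then show ?thesis by simp
qed

text \<open>Exactly one extensional \<open>h\<close> agrees with \<open>m\<close> up to time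
  \<open>k\<close>, namely the restriction of \<open>m\<close>, so a single summand survives.
  Extensional functions make the index set finite.\<close>

lemma depends_upto_expand:
  fixes f :: "(nat \<Rightarrow> 's::finite) \<Rightarrow> 'b::real_vector"
  assumes "depends_upto k f"
  shows "f m = (\<Sum>h\<in>{..k} \<rightarrow>\<^sub>E UNIV. indicator {m. \<forall>l\<le>k. m l = h l} m *\<^sub>R f h)"
proof -
  let ?r = "restrict m {..k}"
  have "(\<Sum>h\<in>{..k} \<rightarrow>\<^sub>E UNIV. indicator {m. \<forall>l\<le>k. m l = h l} m *\<^sub>R f h)
      = (\<Sum>h\<in>{..k} \<rightarrow>\<^sub>E UNIV. if h = ?r then f h else 0)"
    by (intro sum.cong refl) (auto simp: indicator_def PiE_def extensional_def fun_eq_iff)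
  also have "\<dots> = f ?r"
    by (simp add: finite_PiE)
  also have "\<dots> = f m"
    using assms unfolding depends_upto_def by simp
  finally show ?thesis by simp
qed

context
  fixes \<Omega> :: "'w measure" and \<theta> :: "nat \<Rightarrow> 'w \<Rightarrow> 's::finite" and s0 :: 's and P :: "'s \<Rightarrow> 's \<Rightarrow> real"
  assumes dtmc: "is_dtmc \<Omega> \<theta> s0 P"
begin

interpretation prob_space \<Omega>
  using dtmc by (simp add: is_dtmc_def)

lemma measurable_chain [measurable]: "\<theta> k \<in> \<Omega> \<rightarrow>\<^sub>M count_space UNIV"
  using dtmc by (simp add: is_dtmc_def)

lemma history_expand:
  fixes f :: "(nat \<Rightarrow> 's) \<Rightarrow> 'b::real_vector"
  assumes "depends_upto k f" and "\<omega> \<in> space \<Omega>"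
  shows "f (\<lambda>l. \<theta> l \<omega>) =
    (\<Sum>h\<in>{..k} \<rightarrow>\<^sub>E UNIV. indicator {\<omega>\<in>space \<Omega>. \<forall>l\<le>k. \<theta> l \<omega> = h l} \<omega> *\<^sub>R f h)"
  using depends_upto_expand[OF assms(1), of "\<lambda>l. \<theta> l \<omega>"] assms(2) by (simp add: indicator_def)

text \<open>The expansion is a finite combination of indicators of measurable events in a
  probability space. All later exchanges of expectation with finite sums or linear maps rest on
  this.\<close>

lemma integrable_history:
  fixes f :: "(nat \<Rightarrow> 's) \<Rightarrow> 'b::{banach, second_countable_topology}"
  assumes "depends_upto k f"
  shows "integrable \<Omega> (\<lambda>\<omega>. f (\<lambda>l. \<theta> l \<omega>))"
proof -
  have "integrable \<Omega> (\<lambda>\<omega>. \<Sum>h\<in>{..k} \<rightarrow>\<^sub>E UNIV.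
      indicator {\<omega>\<in>space \<Omega>. \<forall>l\<le>k. \<theta> l \<omega> = h l} \<omega> *\<^sub>R f h)"
    by (intro Bochner_Integration.integrable_sum integrable_scaleR_left)
      (auto simp: integrable_indicator_iff emeasure_eq_measure)
  also have "?this \<longleftrightarrow> ?thesis"
    by (intro Bochner_Integration.integrable_cong refl history_expand[OF assms, symmetric])
  finally show ?thesis .
qed

text \<open>The Markov property with the conditional probability multiplied out. A history of
  probability zero is covered too, since both sides then vanish; sums may therefore run over all
  histories.\<close>

lemma prob_history_step:
  "prob {\<omega>\<in>space \<Omega>. (\<forall>l\<le>k. \<theta> l \<omega> = h l) \<and> \<theta> (Suc k) \<omega> = j}
     = P (h k) j * prob {\<omega>\<in>space \<Omega>. \<forall>l\<le>k. \<theta> l \<omega> = h l}" (is "prob ?L = _ * prob ?H")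
proof (cases "prob ?H > 0")
  case True
  then have "\<P>(\<omega> in \<Omega>. \<theta> (Suc k) \<omega> = j \<bar> \<forall>l\<le>k. \<theta> l \<omega> = h l) = P (h k) j"
    using dtmc by (simp add: is_dtmc_def)
  with True show ?thesis
    by (simp add: cond_prob_def field_simps conj_commute)
next
  case False
  then have "prob ?H = 0"
    by (simp add: zero_less_measure_iff)
  moreover have "prob ?L \<le> prob ?H"
    by (rule finite_measure_mono) auto
  ultimately show ?thesis
    by (simp add: measure_le_0_iff)
qed

text \<open>By linearity the Markov property passes from single histories to functionals: on the
  event of history \<open>h\<close>, \<open>f\<close> is the constant \<open>f h\<close> and the
  current mode is \<open>h k\<close>.\<close>

lemma markov_expectation:
  fixes f :: "(nat \<Rightarrow> 's) \<Rightarrow> real"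
  assumes "depends_upto k f"
  shows "expectation (\<lambda>\<omega>. f (\<lambda>l. \<theta> l \<omega>) * indicator {j} (\<theta> (Suc k) \<omega>))
       = expectation (\<lambda>\<omega>. f (\<lambda>l. \<theta> l \<omega>) * P (\<theta> k \<omega>) j)"
proof -
  let ?H = "\<lambda>h. {\<omega>\<in>space \<Omega>. \<forall>l\<le>k. \<theta> l \<omega> = h l}"
  let ?L = "\<lambda>h. {\<omega>\<in>space \<Omega>. (\<forall>l\<le>k. \<theta> l \<omega> = h l) \<and> \<theta> (Suc k) \<omega> = j}"
  let ?F = "{..k} \<rightarrow>\<^sub>E (UNIV :: 's set)"
  have "expectation (\<lambda>\<omega>. f (\<lambda>l. \<theta> l \<omega>) * indicator {j} (\<theta> (Suc k) \<omega>))
      = expectation (\<lambda>\<omega>. \<Sum>h\<in>?F. indicator (?L h) \<omega> * f h)"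
    by (intro Bochner_Integration.integral_cong refl)
      (auto intro!: sum.cong simp: history_expand[OF assms] sum_distrib_right indicator_def)
  also have "\<dots> = (\<Sum>h\<in>?F. prob (?L h) * f h)"
    by (subst Bochner_Integration.integral_sum)
      (auto intro!: integrable_mult_left simp: integrable_indicator_iff emeasure_eq_measure)
  also have "\<dots> = (\<Sum>h\<in>?F. prob (?H h) * (f h * P (h k) j))"
    by (simp add: prob_history_step mult_ac)
  also have "\<dots> = expectation (\<lambda>\<omega>. \<Sum>h\<in>?F. indicator (?H h) \<omega> * (f h * P (h k) j))"
    by (subst Bochner_Integration.integral_sum)
      (auto intro!: integrable_mult_left simp: integrable_indicator_iff emeasure_eq_measure)
  also have "\<dots> = expectation (\<lambda>\<omega>. f (\<lambda>l. \<theta> l \<omega>) * P (\<theta> k \<omega>) j)"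
    by (intro Bochner_Integration.integral_cong refl)
      (auto intro!: sum.cong simp: history_expand[OF assms] sum_distrib_right indicator_def)
  finally show ?thesis .
qed

section \<open>Mode-wise second moments of the state and their decay\<close>

lemma second_moment_step:
  "expectation (\<lambda>\<omega>. (y \<bullet> jls_state A (\<lambda>l. \<theta> l \<omega>) x0 (Suc k))\<^sup>2 * indicator {j} (\<theta> (Suc k) \<omega>))
   = (\<Sum>i\<in>UNIV. P i j * expectation (\<lambda>\<omega>.
        ((transpose (A i) *v y) \<bullet> jls_state A (\<lambda>l. \<theta> l \<omega>) x0 k)\<^sup>2 * indicator {i} (\<theta> k \<omega>)))"
proof -
  let ?x = "\<lambda>\<omega>. jls_state A (\<lambda>l. \<theta> l \<omega>) x0 k"
  \<comment> \<open>Sorting by the current mode \<open>s\<close> turns the random matrix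
    \<open>A s\<close> into a fixed \<open>A i\<close> in each summand, whose transpose can then act
    on \<open>y\<close>.\<close>
  have split: "(y \<bullet> (A s *v x))\<^sup>2 * P s j =
      (\<Sum>i\<in>UNIV. P i j * (((transpose (A i) *v y) \<bullet> x)\<^sup>2 * indicator {i} s))" for s x
    using sum_mult_indicator_singleton[of "\<lambda>i. P i j * ((transpose (A i) *v y) \<bullet> x)\<^sup>2" s]
    by (simp add: dot_lmul_matrix mult_ac)
  \<comment> \<open>The state at time \<open>Suc k\<close> is determined by the modes up to time
    \<open>k\<close>, so the mode at time \<open>Suc k\<close> enters only through the indicator and
    averages to \<open>P (\<theta> k \<omega>) j\<close>.\<close>
  have "expectation (\<lambda>\<omega>. (y \<bullet> jls_state A (\<lambda>l. \<theta> l \<omega>) x0 (Suc k))\<^sup>2 * indicator {j} (\<theta> (Suc k) \<omega>))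
      = expectation (\<lambda>\<omega>. (y \<bullet> (A (\<theta> k \<omega>) *v ?x \<omega>))\<^sup>2 * P (\<theta> k \<omega>) j)"
    using markov_expectation[OF depends_upto_jls_state[of k "\<lambda>i x. (y \<bullet> (A i *v x))\<^sup>2" A x0]]
    by simp
  also have "\<dots> = expectation (\<lambda>\<omega>. \<Sum>i\<in>UNIV. P i j *
      (((transpose (A i) *v y) \<bullet> ?x \<omega>)\<^sup>2 * indicator {i} (\<theta> k \<omega>)))"
    by (simp only: split)
  also have "\<dots> = (\<Sum>i\<in>UNIV. P i j * expectation (\<lambda>\<omega>.
      ((transpose (A i) *v y) \<bullet> ?x \<omega>)\<^sup>2 * indicator {i} (\<theta> k \<omega>)))"
    by (subst Bochner_Integration.integral_sum)
      (auto intro!: integrable_mult_right integrable_history[of k]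
        depends_upto_jls_state[of k "\<lambda>s x. (_ \<bullet> x)\<^sup>2 * indicator {_} s"])
  finally show ?thesis .
qed

lemma second_moment_bound:
  assumes P: "\<And>i j. P i j \<ge> 0" and V: "\<And>i. pos_def (V i)"
    and \<rho>: "\<rho> \<ge> 0" "\<And>j y. y \<bullet> (lyapunov_op A P V j *v y) \<le> \<rho> * (y \<bullet> (V j *v y))"
  shows "\<exists>c. \<forall>k j y. expectation (\<lambda>\<omega>.
      (y \<bullet> jls_state A (\<lambda>l. \<theta> l \<omega>) x0 k)\<^sup>2 * indicator {j} (\<theta> k \<omega>)) \<le> c * \<rho> ^ k * (y \<bullet> (V j *v y))"
proof -
  obtain e where e: "e > 0" "\<And>j y. e * (y \<bullet> y) \<le> y \<bullet> (V j *v y)"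
    using pos_def_coercive_uniform[of V] V by metis
  \<comment> \<open>Chosen so that \<open>c * e = x0 \<bullet> x0\<close>: Cauchy-Schwarz followed
    by coercivity of \<open>V j\<close> then yields the base case.\<close>
  define c where "c = (x0 \<bullet> x0) / e"
  have c: "c \<ge> 0"
    using e by (simp add: c_def)
  have "expectation (\<lambda>\<omega>. (y \<bullet> jls_state A (\<lambda>l. \<theta> l \<omega>) x0 k)\<^sup>2 * indicator {j} (\<theta> k \<omega>))
      \<le> c * \<rho> ^ k * (y \<bullet> (V j *v y))" for k j y
  \<comment> \<open>The direction \<open>y\<close> is generalised because the recursion invokes the
    hypothesis at \<open>transpose (A i) *v y\<close>. Nonnegativity of \<open>P\<close> lets the
    bounds be summed.\<close>
  proof (induction k arbitrary: j y)
    case 0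
    have "expectation (\<lambda>\<omega>. (y \<bullet> x0)\<^sup>2 * indicator {j} (\<theta> 0 \<omega>)) \<le> expectation (\<lambda>\<omega>. (y \<bullet> x0)\<^sup>2)"
    proof (rule integral_mono)
      show "integrable \<Omega> (\<lambda>\<omega>. (y \<bullet> x0)\<^sup>2 * indicator {j} (\<theta> 0 \<omega>))"
        using integrable_history[OF depends_upto_jls_state[of 0 "\<lambda>s x. (y \<bullet> x)\<^sup>2 * indicator {j} s" A x0]]
        by simp
    qed (auto simp: indicator_def)
    also have "\<dots> \<le> (y \<bullet> y) * (x0 \<bullet> x0)"
      by (simp add: prob_space Cauchy_Schwarz_ineq)
    also have "\<dots> = c * (e * (y \<bullet> y))"
      using e by (simp add: c_def)
    also have "\<dots> \<le> c * (y \<bullet> (V j *v y))"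
      by (intro mult_left_mono e c)
    finally show ?case by simp
  next
    case (Suc k)
    let ?z = "\<lambda>i. transpose (A i) *v y"
    have "expectation (\<lambda>\<omega>. (y \<bullet> jls_state A (\<lambda>l. \<theta> l \<omega>) x0 (Suc k))\<^sup>2 * indicator {j} (\<theta> (Suc k) \<omega>))
        \<le> (\<Sum>i\<in>UNIV. P i j * (c * \<rho> ^ k * (?z i \<bullet> (V i *v ?z i))))"
      unfolding second_moment_step by (intro sum_mono mult_left_mono Suc P)
    also have "\<dots> = c * \<rho> ^ k * (y \<bullet> (lyapunov_op A P V j *v y))"
      by (simp add: inner_lyapunov_op sum_distrib_left mult_ac)
    also have "\<dots> \<le> c * \<rho> ^ k * (\<rho> * (y \<bullet> (V j *v y)))"
      using c \<rho> by (intro mult_left_mono) auto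
    finally show ?case by (simp add: mult_ac)
  qed
  then show ?thesis by blast
qed

lemma second_moment_tendsto_0:
  assumes "\<And>i j. P i j \<ge> 0" and "\<And>i. pos_def (V i)"
    and "\<And>j. pos_def (V j - lyapunov_op A P V j)"
  shows "(\<lambda>k. expectation (\<lambda>\<omega>. (y \<bullet> jls_state A (\<lambda>l. \<theta> l \<omega>) x0 k)\<^sup>2)) \<longlonglongrightarrow> 0"
proof -
  let ?q = "\<lambda>k. expectation (\<lambda>\<omega>. (y \<bullet> jls_state A (\<lambda>l. \<theta> l \<omega>) x0 k)\<^sup>2)"
  obtain \<rho> where \<rho>: "0 \<le> \<rho>" "\<rho> < 1"
    and contr: "\<And>j y. y \<bullet> (lyapunov_op A P V j *v y) \<le> \<rho> * (y \<bullet> (V j *v y))"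
    using pos_def_contraction[of V "lyapunov_op A P V"] assms(2,3) by metis
  obtain c where c: "\<And>k j y. expectation (\<lambda>\<omega>.
      (y \<bullet> jls_state A (\<lambda>l. \<theta> l \<omega>) x0 k)\<^sup>2 * indicator {j} (\<theta> k \<omega>)) \<le> c * \<rho> ^ k * (y \<bullet> (V j *v y))"
    using second_moment_bound[OF assms(1,2) \<rho>(1) contr, of x0] by blast
  \<comment> \<open>The indicators of the current mode sum to 1, so adding the mode-wise bounds
    recovers the full second moment.\<close>
  have upper: "?q k \<le> (\<Sum>j\<in>UNIV. c * \<rho> ^ k * (y \<bullet> (V j *v y)))" for k
  proof -
    have "?q k = expectation (\<lambda>\<omega>. \<Sum>j\<in>UNIV.
        (y \<bullet> jls_state A (\<lambda>l. \<theta> l \<omega>) x0 k)\<^sup>2 * indicator {j} (\<theta> k \<omega>))"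
      by (simp add: sum_mult_indicator_singleton)
    also have "\<dots> = (\<Sum>j\<in>UNIV. expectation (\<lambda>\<omega>.
        (y \<bullet> jls_state A (\<lambda>l. \<theta> l \<omega>) x0 k)\<^sup>2 * indicator {j} (\<theta> k \<omega>)))"
      by (intro Bochner_Integration.integral_sum integrable_history[of k]
          depends_upto_jls_state[of k "\<lambda>s x. (y \<bullet> x)\<^sup>2 * indicator {_} s"])
    finally show ?thesis
      by (simp add: c sum_mono)
  qed
  have "(\<lambda>k. \<Sum>j\<in>UNIV. c * \<rho> ^ k * (y \<bullet> (V j *v y))) \<longlonglongrightarrow> (\<Sum>j\<in>UNIV. c * 0 * (y \<bullet> (V j *v y)))"
    using \<rho> by (intro tendsto_intros LIMSEQ_realpow_zero) auto
  then have "(\<lambda>k. \<Sum>j\<in>UNIV. c * \<rho> ^ k * (y \<bullet> (V j *v y))) \<longlonglongrightarrow> 0"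
    by simp
  from tendsto_sandwich[OF _ _ tendsto_const this] show ?thesis
    by (simp add: upper)
qed

section \<open>Entries and norm of the second-moment matrix\<close>

lemma expectation_outer_self_nth:
  fixes A :: "'s \<Rightarrow> real^'n^'n"
  shows
  "expectation (\<lambda>\<omega>. outer_self (jls_state A (\<lambda>l. \<theta> l \<omega>) x0 k)) $ a $ b
   = expectation (\<lambda>\<omega>. jls_state A (\<lambda>l. \<theta> l \<omega>) x0 k $ a * jls_state A (\<lambda>l. \<theta> l \<omega>) x0 k $ b)"
proof -
  have "bounded_linear (\<lambda>B :: real^'n^'n. B $ a $ b)"
    by (rule bounded_linear_compose[OF bounded_linear_vec_nth bounded_linear_vec_nth])
  \<comment> \<open>Integrability of the matrix-valued map lets the Bochner integral commute with
    taking an entry.\<close>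
  from integral_bounded_linear[OF this
      integrable_history[OF depends_upto_jls_state[of k "\<lambda>_. outer_self" A x0]]]
  show ?thesis
    by (simp add: outer_self_def)
qed

lemma abs_expectation_outer_self_nth_le:
  fixes A :: "'s \<Rightarrow> real^'n^'n"
  shows "\<bar>expectation (\<lambda>\<omega>. outer_self (jls_state A (\<lambda>l. \<theta> l \<omega>) x0 k)) $ a $ b\<bar>
   \<le> expectation (\<lambda>\<omega>. (axis a 1 \<bullet> jls_state A (\<lambda>l. \<theta> l \<omega>) x0 k)\<^sup>2)
     + expectation (\<lambda>\<omega>. (axis b 1 \<bullet> jls_state A (\<lambda>l. \<theta> l \<omega>) x0 k)\<^sup>2)"
proof -
  let ?x = "\<lambda>\<omega>. jls_state A (\<lambda>l. \<theta> l \<omega>) x0 k"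
  have int: "integrable \<Omega> (\<lambda>\<omega>. f (?x \<omega>))" for f :: "real^'n \<Rightarrow> real"
    by (rule integrable_history[OF depends_upto_jls_state[of k "\<lambda>_. f"]])
  \<comment> \<open>The sharp bound has a factor 1/2; it is dropped because only convergence to 0
    matters.\<close>
  have amgm: "\<bar>u * v\<bar> \<le> u\<^sup>2 + v\<^sup>2" for u v :: real
  proof -
    have "2 * \<bar>u\<bar> * \<bar>v\<bar> \<le> \<bar>u\<bar>\<^sup>2 + \<bar>v\<bar>\<^sup>2"
      by (rule sum_squares_bound)
    then show ?thesis
      using mult_nonneg_nonneg[OF abs_ge_zero[of u] abs_ge_zero[of v]] unfolding abs_mult power2_abs by linarith
  qed
  have "\<bar>expectation (\<lambda>\<omega>. ?x \<omega> $ a * ?x \<omega> $ b)\<bar> \<le> expectation (\<lambda>\<omega>. \<bar>?x \<omega> $ a * ?x \<omega> $ b\<bar>)"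
    by (rule integral_abs_bound)
  also have "\<dots> \<le> expectation (\<lambda>\<omega>. (?x \<omega> $ a)\<^sup>2 + (?x \<omega> $ b)\<^sup>2)"
    by (intro integral_mono amgm int[of "\<lambda>x. \<bar>x $ a * x $ b\<bar>"] int[of "\<lambda>x. (x $ a)\<^sup>2 + (x $ b)\<^sup>2"])
  also have "\<dots> = expectation (\<lambda>\<omega>. (?x \<omega> $ a)\<^sup>2) + expectation (\<lambda>\<omega>. (?x \<omega> $ b)\<^sup>2)"
    by (intro Bochner_Integration.integral_add int[of "\<lambda>x. (x $ a)\<^sup>2"] int[of "\<lambda>x. (x $ b)\<^sup>2"])
  finally show ?thesis
    by (simp add: expectation_outer_self_nth inner_axis')
qed

end

text \<open>The largest absolute row sum is at most the sum of all absolute entries, a finite sum of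
  null sequences, so no limit of a maximum has to be taken.\<close>

lemma matrix_norm_inf_tendsto_0:
  fixes B :: "nat \<Rightarrow> real^'n^'m"
  assumes "\<And>a b. (\<lambda>k. B k $ a $ b) \<longlonglongrightarrow> 0"
  shows "(\<lambda>k. matrix_norm_inf (B k)) \<longlonglongrightarrow> 0"
proof -
  have lim: "(\<lambda>k. \<Sum>a\<in>UNIV. \<Sum>b\<in>UNIV. \<bar>B k $ a $ b\<bar>) \<longlonglongrightarrow> 0"
    by (intro tendsto_null_sum tendsto_rabs_zero assms)
  have "0 \<le> matrix_norm_inf (B k)" for k
    unfolding matrix_norm_inf_def by (subst Max_ge_iff) (auto intro: sum_nonneg)
  moreover have "matrix_norm_inf (B k) \<le> (\<Sum>a\<in>UNIV. \<Sum>b\<in>UNIV. \<bar>B k $ a $ b\<bar>)" for k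
    unfolding matrix_norm_inf_def
    by (subst Max_le_iff)
      (auto intro!: member_le_sum[where f = "\<lambda>a. \<Sum>b\<in>UNIV. \<bar>B k $ a $ b\<bar>"] sum_nonneg)
  ultimately show ?thesis
    using tendsto_sandwich[OF _ _ tendsto_const lim] by simp
qed

theorem theorem2:
  fixes \<M> :: "('s::finite, 'a::finite) mdp"
    and A V :: "'s \<Rightarrow> real^'n^'n"
    and \<pi> :: "'s \<Rightarrow> 'a \<Rightarrow> real"
    and \<Omega> :: "'w measure"
    and \<theta> :: "nat \<Rightarrow> 'w \<Rightarrow> 's"
  assumes "is_mdp \<M>"
    and "is_policy \<M> \<pi>"
    and "\<And>i. pos_def (V i)"
    and "\<And>j. pos_def (V j - lyapunov_op A (induced_trans \<M> \<pi>) V j)"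
    and "is_dtmc \<Omega> \<theta> (mdp_init \<M>) (induced_trans \<M> \<pi>)"
  shows "mean_square_stable \<Omega> \<theta> A"
proof -
  have nonneg: "induced_trans \<M> \<pi> i j \<ge> 0" for i j
    using assms(1,2)
    by (auto simp: induced_trans_def is_mdp_def is_policy_def intro!: sum_nonneg mult_nonneg_nonneg)
  note lim = second_moment_tendsto_0[OF assms(5) nonneg assms(3,4)]
  show ?thesis
    unfolding mean_square_stable_def
  proof (intro allI matrix_norm_inf_tendsto_0)
    fix x0 a b
    show "(\<lambda>k. prob_space.expectation \<Omega>
        (\<lambda>\<omega>. outer_self (jls_state A (\<lambda>l. \<theta> l \<omega>) x0 k)) $ a $ b) \<longlonglongrightarrow> 0"
      \<comment> \<open>The absolute value of the entry is squeezed between 0 and the sum of the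
        second moments along the coordinate vectors \<open>axis a 1\<close> and
        \<open>axis b 1\<close>.\<close>
      by (rule tendsto_rabs_zero_cancel, rule tendsto_sandwich[OF _ _ tendsto_const
            tendsto_add_zero[OF lim[of "axis a 1" x0] lim[of "axis b 1" x0]]])
        (simp_all add: abs_expectation_outer_self_nth_le[OF assms(5)])
  qed
qed

end
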